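(* Let $P$ be a connected finite poset with more than one point. If $E(P)$ does not contain a crown, then $P$ is I-dismantlable to a singleton.
   Context: $L(P)$, $U(P)$: minimal and maximal points of $P=(X,\leq_P)$; $E(P)=L(P)\cup U(P)$ with the induced order. A subset is a crown if its comparability graph (edges between distinct comparable elements) is a cycle. A point $x$ is irreducible if $({\downarrow}_P x)\setminus\{x\}$ has a single maximal point or $({\uparrow}_P x)\setminus\{x\}$ has a single minimal point; then for such a point $z$, the map sending $x\mapsto z$ and fixing all other points is a retraction of $P$ onto $P|_{X\setminus\{x\}}$, called an I-retraction. $P$ is I-dismantlable to $P'$ if there is a sequence of I-retractions $r_j:Q_{j-1}\to Q_j$, $1\le j\le J$, with $Q_0=P$ and $Q_J=P'$. *)

theory Defs
  imports Main
begin

text \<open>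
  A poset is given by its reflexive order relation \<open>r\<close> (with \<open>Partial_order r\<close>); its set of
  points is \<open>Field r\<close>, and \<open>(x, y) \<in> r\<close> means \<open>x \<le> y\<close>. The subposet induced on \<open>A\<close> is \<open>Restr r A\<close>.
\<close>

definition minimal_points :: "'a rel \<Rightarrow> 'a set \<Rightarrow> 'a set" where
  "minimal_points r S = {x \<in> S. \<forall>y\<in>S. (y, x) \<in> r \<longrightarrow> y = x}"

definition maximal_points :: "'a rel \<Rightarrow> 'a set \<Rightarrow> 'a set" where
  "maximal_points r S = {x \<in> S. \<forall>y\<in>S. (x, y) \<in> r \<longrightarrow> y = x}"

definition extremal_poset :: "'a rel \<Rightarrow> 'a rel" where
  "extremal_poset r =
     Restr r (minimal_points r (Field r) \<union> maximal_points r (Field r))"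

definition connected_poset :: "'a rel \<Rightarrow> bool" where
  "connected_poset r \<longleftrightarrow> (\<forall>x\<in>Field r. \<forall>y\<in>Field r. (x, y) \<in> (r \<union> r\<inverse>)\<^sup>*)"

definition comparability_edges :: "'a rel \<Rightarrow> 'a set \<Rightarrow> 'a set set" where
  "comparability_edges r C = {{x, y} | x y. x \<in> C \<and> y \<in> C \<and> x \<noteq> y \<and> (x, y) \<in> r}"

definition cycle_graph :: "'a set \<Rightarrow> 'a set set \<Rightarrow> bool" where
  "cycle_graph V E \<longleftrightarrow>
     (\<exists>n c. 3 \<le> n \<and> bij_betw c {..<n} V \<and> E = {{c i, c (Suc i mod n)} | i. i < n})"

definition crown :: "'a rel \<Rightarrow> 'a set \<Rightarrow> bool" where
  "crown r C \<longleftrightarrow> C \<subseteq> Field r \<and> cycle_graph C (comparability_edges r C)"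

text \<open>
  \<open>underS r x\<close> and \<open>aboveS r x\<close> are the down-set and the up-set of \<open>x\<close> without \<open>x\<close> itself.
  A point is irreducible if it is irreducible via some \<open>z\<close>; the \<open>z\<close> need not be unique, as
  both alternatives may hold.
\<close>

definition irreducible_via :: "'a rel \<Rightarrow> 'a \<Rightarrow> 'a \<Rightarrow> bool" where
  "irreducible_via r x z \<longleftrightarrow>
     x \<in> Field r \<and>
     (maximal_points r (underS r x) = {z} \<or> minimal_points r (aboveS r x) = {z})"

text \<open>
  Maps between posets are HOL functions whose values outside the points of the domain are
  irrelevant. In a finite poset, the map of an I-retraction is a retraction, see below.
\<close>

definition I_retraction :: "'a rel \<Rightarrow> 'a rel \<Rightarrow> ('a \<Rightarrow> 'a) \<Rightarrow> bool" where
  "I_retraction r r' f \<longleftrightarrow>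
     (\<exists>x z. irreducible_via r x z \<and> f x = z \<and> (\<forall>y \<in> Field r - {x}. f y = y) \<and>
       r' = Restr r (Field r - {x}))"

definition I_dismantlable :: "'a rel \<Rightarrow> 'a rel \<Rightarrow> bool" where
  "I_dismantlable r r' \<longleftrightarrow>
     (\<exists>(J::nat) Q f. Q 0 = r \<and> Q J = r' \<and>
       (\<forall>j\<in>{1..J}. I_retraction (Q (j - 1)) (Q j) (f j)))"

lemma maximal_point_above:
  assumes "finite S" "antisym r" "trans r" "y \<in> S"
  shows "\<exists>m \<in> maximal_points r S. y = m \<or> (y, m) \<in> r"
proof -
  let ?T = "{m \<in> S. y = m \<or> (y, m) \<in> r}"
  have "\<exists>m \<in> ?T. \<forall>x \<in> ?T. x \<noteq> m \<longrightarrow> \<not> ((m, x) \<in> r \<and> m \<noteq> x)"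
    by (rule Finite_Set.bex_max_element)
      (use assms in \<open>auto simp: asymp_on_def transp_on_def dest: antisymD transD\<close>)
  with assms show ?thesis
    unfolding maximal_points_def by (blast dest: transD)
qed

lemma minimal_points_converse: "minimal_points r S = maximal_points (r\<inverse>) S"
  by (simp add: minimal_points_def maximal_points_def)

lemma I_retraction_retraction:
  assumes "Partial_order r" "finite (Field r)" "I_retraction r r' f"
  shows "r' = Restr r (Field r')" "f ` Field r = Field r'" "\<forall>y\<in>Field r'. f y = y"
    "\<forall>a b. (a, b) \<in> r \<longrightarrow> (f a, f b) \<in> r"
proof -
  have po: "antisym r" "trans r" "\<And>a. a \<in> Field r \<Longrightarrow> (a, a) \<in> r"
    using assms(1) by (auto simp: partial_order_on_def preorder_on_def refl_on_def)
  obtain x z where x: "irreducible_via r x z" and f: "f x = z" "\<And>y. y \<in> Field r - {x} \<Longrightarrow> f y = y"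
    and r': "r' = Restr r (Field r - {x})"
    using assms(3) unfolding I_retraction_def by blast
  have F: "Field r' = Field r - {x}"
    using po(3) unfolding r' Field_def by blast
  have xF: "x \<in> Field r" and cases:
    "maximal_points r (underS r x) = {z} \<or> minimal_points r (aboveS r x) = {z}"
    using x unfolding irreducible_via_def by auto
  have fin: "finite (underS r x)" "finite (aboveS r x)"
    by (auto intro!: finite_subset[OF _ assms(2)] simp: underS_def aboveS_def Field_def)
  have z: "z \<in> Field r" "z \<noteq> x" "((z, x) \<in> r \<and> (\<forall>y. (y, x) \<in> r \<and> y \<noteq> x \<longrightarrow> (y, z) \<in> r)) \<or>
      ((x, z) \<in> r \<and> (\<forall>y. (x, y) \<in> r \<and> y \<noteq> x \<longrightarrow> (z, y) \<in> r))"
  proof -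
    have "((z, x) \<in> r \<and> z \<noteq> x \<and> (\<forall>y. (y, x) \<in> r \<and> y \<noteq> x \<longrightarrow> (y, z) \<in> r)) \<or>
      ((x, z) \<in> r \<and> z \<noteq> x \<and> (\<forall>y. (x, y) \<in> r \<and> y \<noteq> x \<longrightarrow> (z, y) \<in> r))"
      using cases
    proof
      assume m: "maximal_points r (underS r x) = {z}"
      have "z \<in> underS r x" using m unfolding maximal_points_def by blast
      moreover have "y = z \<or> (y, z) \<in> r" if "y \<in> underS r x" for y
        using maximal_point_above[OF fin(1) po(1,2) that] m by simp
      ultimately show ?thesis
        using po(3) unfolding underS_def Field_def by blast
    next
      assume m: "minimal_points r (aboveS r x) = {z}"
      have "z \<in> aboveS r x" using m unfolding minimal_points_def by blast
      moreover have "y = z \<or> (z, y) \<in> r" if "y \<in> aboveS r x" for y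
        using maximal_point_above[OF fin(2), of "r\<inverse>" y] that po(1,2) m
        by (simp add: minimal_points_converse)
      ultimately show ?thesis
        using po(3) unfolding aboveS_def Field_def by blast
    qed
    then show "z \<in> Field r" "z \<noteq> x" "((z, x) \<in> r \<and> (\<forall>y. (y, x) \<in> r \<and> y \<noteq> x \<longrightarrow> (y, z) \<in> r)) \<or>
      ((x, z) \<in> r \<and> (\<forall>y. (x, y) \<in> r \<and> y \<noteq> x \<longrightarrow> (z, y) \<in> r))"
      unfolding Field_def by blast+
  qed
  show "r' = Restr r (Field r')" using r' F by simp
  show "\<forall>y\<in>Field r'. f y = y" using f(2) F by blast
  have "f a \<in> Field r'" if "a \<in> Field r" for a
    using that f z F by (cases "a = x") auto
  moreover have "a \<in> f ` Field r" if "a \<in> Field r'" for a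
    using that f(2)[of a] F by (metis DiffD1 imageI)
  ultimately show "f ` Field r = Field r'" by blast
  show "\<forall>a b. (a, b) \<in> r \<longrightarrow> (f a, f b) \<in> r"
  proof (intro allI impI)
    fix a b assume ab: "(a, b) \<in> r"
    then have abF: "a \<in> Field r" "b \<in> Field r" unfolding Field_def by blast+
    show "(f a, f b) \<in> r"
    proof (cases "a = x")
      case True
      show ?thesis
      proof (cases "b = x")
        case True with \<open>a = x\<close> f(1) z(1) po(3) show ?thesis by simp
      next
        case False
        with abF f ab \<open>a = x\<close> have "f a = z" "f b = b" by auto
        with z(3) ab \<open>a = x\<close> False po(2) show ?thesis by (metis transD)
      qed
    next
      case False
      then have fa: "f a = a" using abF f by auto
      show ?thesis
      proof (cases "b = x")
        case True
        with z(3) ab False po(2) fa f(1) show ?thesis by (metis transD)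
      next
        case False
        with abF f ab fa show ?thesis by auto
      qed
    qed
  qed
qed

end

theory Submission
  imports Defs
begin

text \<open>
  A crown is an induced cycle of the comparability graph, and a finite graph without induced
  cycles has a vertex with at most one neighbour. Hence if \<open>E(P)\<close> has no crown, then below or above
  each non-extremal point there is exactly one extremal point, as otherwise two minimal and two
  maximal points would be pairwise comparable. Walking from that point towards the unique extremal
  point, one ends in a non-extremal point that is irreducible; removing it leaves \<open>E(P)\<close> unchanged.
  When only extremal points are left, a point with a single neighbour is irreducible.
\<close>

section \<open>Induced paths and crowns in the comparability graph\<close>

definition adjacent :: "'a rel \<Rightarrow> 'a \<Rightarrow> 'a \<Rightarrow> bool" where
  "adjacent r x y \<longleftrightarrow> x \<noteq> y \<and> ((x, y) \<in> r \<or> (y, x) \<in> r)"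

lemma adjacent_sym: "adjacent r x y \<longleftrightarrow> adjacent r y x"
  unfolding adjacent_def by blast

text \<open>Edges are unordered pairs, so both orientations of a comparability give the same edge;
  the graph arguments can then use the symmetric relation \<open>adjacent\<close>.\<close>

lemma comparability_edges_adjacent:
  "comparability_edges r C = {{x, y} | x y. x \<in> C \<and> y \<in> C \<and> adjacent r x y}"
proof (intro equalityI subsetI)
  fix e assume "e \<in> {{x, y} | x y. x \<in> C \<and> y \<in> C \<and> adjacent r x y}"
  then obtain x y where "x \<in> C" "y \<in> C" "adjacent r x y" "e = {x, y}" "e = {y, x}" by blast
  then show "e \<in> comparability_edges r C"
    unfolding comparability_edges_def adjacent_def by blast
qed (auto simp: comparability_edges_def adjacent_def)

text \<open>Here \<open>k\<close> is the number of edges: the vertices are \<open>p 0\<close> to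
  \<open>p k\<close>, and values of \<open>p\<close> beyond \<open>k\<close> are irrelevant. The
  equivalence excludes chords.\<close>

definition induced_path :: "'a rel \<Rightarrow> 'a set \<Rightarrow> nat \<Rightarrow> (nat \<Rightarrow> 'a) \<Rightarrow> bool" where
  "induced_path r V k p \<longleftrightarrow> p ` {..k} \<subseteq> V \<and> inj_on p {..k} \<and>
     (\<forall>i\<le>k. \<forall>j\<le>k. adjacent r (p i) (p j) \<longleftrightarrow> i = Suc j \<or> j = Suc i)"

text \<open>Paths grow at their start \<open>p 0\<close>: \<open>case_nat w p\<close> puts
  \<open>w\<close> at index 0 and shifts all other indices by one.\<close>

lemma induced_path_Cons:
  assumes p: "induced_path r V k p" and w: "w \<in> V" "w \<notin> p ` {..k}" "adjacent r w (p 0)"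
    and nadj: "\<And>j. 0 < j \<Longrightarrow> j \<le> k \<Longrightarrow> \<not> adjacent r w (p j)"
  shows "induced_path r V (Suc k) (case_nat w p)"
proof -
  have "case_nat w p ` {..Suc k} = insert w (p ` {..k})"
    by (simp add: atMost_Suc_eq_insert_0 image_image)
  with p w(1) have "case_nat w p ` {..Suc k} \<subseteq> V"
    unfolding induced_path_def by simp
  moreover have "inj_on (case_nat w p) {..Suc k}"
    using p w(2) unfolding induced_path_def
    by (auto simp: atMost_Suc_eq_insert_0 inj_on_def)
  moreover have "adjacent r (case_nat w p i) (case_nat w p j) \<longleftrightarrow> i = Suc j \<or> j = Suc i"
    if "i \<le> Suc k" "j \<le> Suc k" for i j
  proof -
    have w0: "adjacent r w (p m) \<longleftrightarrow> m = 0" if "m \<le> k" for m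
      using that w(3) nadj[of m] by auto
    then have "adjacent r (p m) w \<longleftrightarrow> m = 0" if "m \<le> k" for m
      using that adjacent_sym[of r w] by blast
    moreover have "\<not> adjacent r w w" by (simp add: adjacent_def)
    ultimately show ?thesis
      using that w0 p by (auto simp: induced_path_def split: nat.splits)
  qed
  ultimately show ?thesis unfolding induced_path_def by simp
qed

text \<open>The crown is \<open>w\<close>, \<open>p 0\<close>, ..., \<open>p m\<close>. As
  \<open>m\<close> is the first index after 0 at which \<open>w\<close> has a neighbour, this cycle
  has no chords, and \<open>0 < m\<close> gives it at least three vertices.\<close>

lemma crown_if_path_closes:
  assumes p: "induced_path r V k p" and V: "V \<subseteq> Field r"
    and w: "w \<in> V" "w \<notin> p ` {..k}" "adjacent r w (p 0)"
    and m: "0 < m" "m \<le> k" "adjacent r w (p m)"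
    and nadj: "\<And>j. 0 < j \<Longrightarrow> j < m \<Longrightarrow> \<not> adjacent r w (p j)"
  shows "\<exists>C. crown r C"
proof -
  define n where "n = Suc (Suc m)"
  define c where "c = case_nat w p"
  define C where "C = c ` {..<n}"
  have [simp]: "c 0 = w" "\<And>i. c (Suc i) = p i" by (simp_all add: c_def)
  have "inj_on c {..<n}"
  proof (rule inj_onI)
    fix a b assume "a \<in> {..<n}" "b \<in> {..<n}" "c a = c b"
    with p w(2) m(2) show "a = b"
      unfolding induced_path_def inj_on_def n_def
      by (cases a; cases b) (auto simp: image_iff)
  qed
  then have bij: "bij_betw c {..<n} C" by (simp add: C_def bij_betw_def)
  have CV: "C \<subseteq> V"
  proof
    fix x assume "x \<in> C"
    then obtain i where "i < n" "x = c i" unfolding C_def by blast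
    with p w(1) m(2) show "x \<in> V"
      unfolding induced_path_def n_def by (cases i) auto
  qed
  have padj: "adjacent r (p i) (p j) \<longleftrightarrow> i = Suc j \<or> j = Suc i" if "i \<le> m" "j \<le> m" for i j
    using that p m(2) unfolding induced_path_def by auto
  have wadj: "adjacent r w (p j) \<longleftrightarrow> j = 0 \<or> j = m" if "j \<le> m" for j
    using that w(3) m(3) nadj[of j] by (cases "j = 0"; cases "j = m") auto
  \<comment> \<open>The second alternative is the closing edge between \<open>w\<close> and
    \<open>p m\<close>, the vertices with indices 0 and \<open>n - 1\<close>.\<close>
  have adj: "adjacent r (c i) (c j) \<longleftrightarrow> j = Suc i \<or> i = 0 \<and> j = Suc m" if "i < j" "j < n" for i j
    using that padj wadj by (cases i; cases j) (auto simp: n_def)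
  have "comparability_edges r C = {{c i, c (Suc i mod n)} | i. i < n}"
  proof (intro equalityI subsetI)
    fix e assume "e \<in> comparability_edges r C"
    then obtain i j where ij: "i < n" "j < n" "e = {c i, c j}" "adjacent r (c i) (c j)"
      unfolding comparability_edges_adjacent C_def by blast
    then have "i \<noteq> j" by (auto simp: adjacent_def)
    obtain a b where ab: "a < b" "b < n" "e = {c a, c b}" "adjacent r (c a) (c b)"
    proof (cases "i < j")
      case True with that ij show ?thesis by blast
    next
      case False with \<open>i \<noteq> j\<close> ij adjacent_sym[of r] show ?thesis
        by (intro that[of j i]) auto
    qed
    from ab adj[OF ab(1,2)] consider "b = Suc a" | "a = 0" "b = Suc m" by blast
    then show "e \<in> {{c i, c (Suc i mod n)} | i. i < n}"
    proof cases
      case 1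
      with ab show ?thesis by (intro CollectI exI[of _ a]) auto
    next
      case 2
      \<comment> \<open>The closing edge is listed under the last index, whose successor wraps
        around to 0.\<close>
      with ab show ?thesis by (intro CollectI exI[of _ b]) (auto simp: n_def)
    qed
  next
    fix e assume "e \<in> {{c i, c (Suc i mod n)} | i. i < n}"
    then obtain i where i: "i < n" "e = {c i, c (Suc i mod n)}" by blast
    have "adjacent r (c i) (c (Suc i mod n))"
    proof (cases "Suc i = n")
      case True
      with m(3) show ?thesis by (simp add: n_def adjacent_sym)
    next
      case False
      with i(1) adj[of i "Suc i"] show ?thesis by simp
    qed
    moreover have "c i \<in> C" "c (Suc i mod n) \<in> C"
      using i(1) by (auto simp: C_def)
    ultimately show "e \<in> comparability_edges r C"
      unfolding comparability_edges_adjacent i(2) by blast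
  qed
  moreover have "3 \<le> n" using m(1) by (simp add: n_def)
  ultimately have "cycle_graph C (comparability_edges r C)"
    using bij unfolding cycle_graph_def by blast
  with CV V show ?thesis unfolding crown_def by blast
qed

text \<open>An end point of a longest induced path has a second neighbour, which closes a crown.\<close>

lemma crown_if_two_neighbours:
  assumes V: "finite V" "V \<noteq> {}" "V \<subseteq> Field r"
    and deg: "\<And>x. x \<in> V \<Longrightarrow> \<exists>y\<in>V. \<exists>z\<in>V. y \<noteq> z \<and> adjacent r x y \<and> adjacent r x z"
  shows "\<exists>C. crown r C"
proof -
  obtain v where "v \<in> V" using V(2) by blast
  then have "induced_path r V 0 (\<lambda>_. v)"
    by (simp add: induced_path_def adjacent_def)
  then have ex: "\<exists>p. induced_path r V 0 p" by blast
  \<comment> \<open>By injectivity the \<open>k + 1\<close> vertices fit into \<open>V\<close>, so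
    there is a longest induced path.\<close>
  have bound: "k < card V" if "induced_path r V k p" for k p
    using that card_inj_on_le[of p "{..k}" V] V(1) unfolding induced_path_def by simp
  define L where "L k \<longleftrightarrow> (\<exists>p. induced_path r V k p)" for k
  define k where "k = Greatest L"
  have bound': "i \<le> card V" if "L i" for i
    using that bound unfolding L_def by (blast intro: less_imp_le)
  have "L k" unfolding k_def using ex bound' by (intro GreatestI_nat[of L 0]) (auto simp: L_def)
  then obtain p where p: "induced_path r V k p" unfolding L_def by blast
  have longest: "k' \<le> k" if "induced_path r V k' q" for k' q
    unfolding k_def using that bound' by (intro Greatest_le_nat) (auto simp: L_def)
  have "p 0 \<in> V" using p unfolding induced_path_def by blast
  \<comment> \<open>Of two neighbours of \<open>p 0\<close>, one differs from \<open>p 1\<close>. If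
    \<open>k = 0\<close>, then \<open>p 1\<close> is not on the path and any neighbour will
    do.\<close>
  then obtain w where w: "w \<in> V" "adjacent r (p 0) w" "k = 0 \<or> w \<noteq> p 1"
    using deg by metis
  have wp: "w \<notin> p ` {..k}"
  proof
    assume "w \<in> p ` {..k}"
    then obtain i where i: "i \<le> k" "w = p i" by blast
    then have "i = Suc 0" using p w(2) unfolding induced_path_def by auto
    with i w(3) show False by simp
  qed
  have wadj: "adjacent r w (p 0)" using w(2) adjacent_sym[of r] by blast
  define Q where "Q j \<longleftrightarrow> 0 < j \<and> j \<le> k \<and> adjacent r w (p j)" for j
  \<comment> \<open>If \<open>p 0\<close> were the only neighbour of \<open>w\<close> on the path,
    prepending \<open>w\<close> would give a longer induced path.\<close>
  have "\<exists>j. Q j"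
  proof (rule ccontr)
    assume "\<not> (\<exists>j. Q j)"
    then have "induced_path r V (Suc k) (case_nat w p)"
      by (intro induced_path_Cons[OF p w(1) wp wadj]) (auto simp: Q_def)
    with longest show False by fastforce
  qed
  then have "Q (LEAST j. Q j)" by (rule LeastI_ex)
  moreover have "\<not> Q j" if "j < (LEAST j. Q j)" for j
    using that by (rule not_less_Least)
  ultimately show ?thesis
    by (intro crown_if_path_closes[OF p V(3) w(1) wp wadj, of "LEAST j. Q j"])
      (auto simp: Q_def)
qed

section \<open>Restriction, connectedness and composition of I-retractions\<close>

text \<open>Being a crown depends only on the order among the points of \<open>C\<close>, which the
  restriction to a superset of \<open>C\<close> keeps.\<close>

lemma crown_Restr:
  assumes "crown (Restr r A) C"
  shows "crown r C"
proof -
  have C: "C \<subseteq> Field (Restr r A)" using assms unfolding crown_def by blast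
  then have "C \<subseteq> A" "C \<subseteq> Field r" unfolding Field_def by blast+
  moreover from this have "comparability_edges (Restr r A) C = comparability_edges r C"
    unfolding comparability_edges_def by blast
  ultimately show ?thesis using assms unfolding crown_def by simp
qed

text \<open>Reflexivity keeps even the isolated points of \<open>A\<close> in the field.\<close>

lemma Field_Restr_Partial_order:
  assumes "Partial_order r" "A \<subseteq> Field r"
  shows "Field (Restr r A) = A"
  using assms by (auto simp: partial_order_on_def preorder_on_def refl_on_def Field_def)

text \<open>The retraction preserves the order and is onto, so it carries a zigzag between two
  points to a zigzag between their images.\<close>

lemma connected_I_retraction:
  assumes "Partial_order r" "finite (Field r)" "connected_poset r" "I_retraction r r' f"
  shows "connected_poset r'"
proof -
  note retr = I_retraction_retraction[OF assms(1,2,4)]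
  have edge: "(f a, f b) \<in> r' \<union> r'\<inverse>" if "(a, b) \<in> r \<union> r\<inverse>" for a b
  proof -
    have "a \<in> Field r" "b \<in> Field r" using that by (auto simp: Field_def)
    then have "f a \<in> Field r'" "f b \<in> Field r'" using retr(2) by blast+
    with that retr(4) show ?thesis by (subst (1 2) retr(1)) blast
  qed
  have "(f a, f b) \<in> (r' \<union> r'\<inverse>)\<^sup>*" if "(a, b) \<in> (r \<union> r\<inverse>)\<^sup>*" for a b
    using that
  proof induction
    case (step b c)
    then show ?case using edge by (meson rtrancl.rtrancl_into_rtrancl)
  qed simp
  then show ?thesis
    using assms(3) unfolding connected_poset_def retr(2)[symmetric] by blast
qed

text \<open>The posets are indexed from 0 but the maps from 1. Hence \<open>case_nat\<close> shifts
  the former, while the new map \<open>f\<close> is placed at index 1.\<close>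

lemma I_dismantlable_Cons:
  assumes "I_retraction r r' f" "I_dismantlable r' r''"
  shows "I_dismantlable r r''"
proof -
  obtain J :: nat and Q g where Q: "Q 0 = r'" "Q J = r''"
    "\<And>j. j \<in> {1..J} \<Longrightarrow> I_retraction (Q (j - 1)) (Q j) (g j)"
    using assms(2) unfolding I_dismantlable_def by blast
  have "I_retraction (case_nat r Q (j - 1)) (case_nat r Q j) (if j = 1 then f else g (j - 1))"
    if j: "j \<in> {1..Suc J}" for j
  proof -
    obtain i where i: "j = Suc i" using j by (cases j) auto
    show ?thesis
    proof (cases i)
      case 0
      with i Q(1) assms(1) show ?thesis by simp
    next
      case (Suc l)
      with i j Q(3)[of i] show ?thesis by simp
    qed
  qed
  then show ?thesis
    unfolding I_dismantlable_def
    by (intro exI[of _ "Suc J"] exI[of _ "case_nat r Q"]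
        exI[of _ "\<lambda>j. if j = 1 then f else g (j - 1)"]) (simp add: Q)
qed

section \<open>Extremal points after a removal\<close>

definition extremal_points :: "'a rel \<Rightarrow> 'a set" where
  "extremal_points r = minimal_points r (Field r) \<union> maximal_points r (Field r)"

text \<open>Some minimal point \<open>a\<close> lies strictly below \<open>y\<close>. A point above
  \<open>y\<close> is therefore still above \<open>a\<close>, so removing \<open>y\<close> creates
  no new minimal point.\<close>

lemma minimal_points_remove:
  assumes "Partial_order r" "finite (Field r)" "y \<in> Field r" "y \<notin> minimal_points r (Field r)"
  shows "minimal_points r (Field r - {y}) = minimal_points r (Field r)"
proof -
  have po: "antisym r" "trans r" using assms(1) by (auto simp: partial_order_on_def preorder_on_def)
  obtain a where a: "a \<in> minimal_points r (Field r)" "(a, y) \<in> r" "a \<noteq> y"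
    using maximal_point_above[of "Field r" "r\<inverse>" y] assms po
    by (auto simp: minimal_points_converse)
  then have aF: "a \<in> Field r - {y}" unfolding minimal_points_def by blast
  have "x \<in> minimal_points r (Field r)" if x: "x \<in> minimal_points r (Field r - {y})" for x
  proof -
    have "(y, x) \<notin> r"
    proof
      assume "(y, x) \<in> r"
      with a(2) po(2) have "(a, x) \<in> r" by (blast dest: transD)
      with x aF have "a = x" unfolding minimal_points_def by blast
      with \<open>(y, x) \<in> r\<close> a po(1) show False by (blast dest: antisymD)
    qed
    with x show ?thesis unfolding minimal_points_def by blast
  qed
  moreover have "minimal_points r (Field r) \<subseteq> minimal_points r (Field r - {y})"
    using assms(4) unfolding minimal_points_def by blast
  ultimately show ?thesis by blast
qed

lemma maximal_points_remove:
  assumes "Partial_order r" "finite (Field r)" "y \<in> Field r" "y \<notin> maximal_points r (Field r)"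
  shows "maximal_points r (Field r - {y}) = maximal_points r (Field r)"
  using minimal_points_remove[of "r\<inverse>" y] assms by (simp add: minimal_points_converse)

text \<open>Both sets of extremal points survive the removal, so the absence of crowns in E(P)
  carries over to the smaller poset.\<close>

lemma extremal_poset_remove:
  assumes "Partial_order r" "finite (Field r)" "y \<in> Field r" "y \<notin> extremal_points r"
  shows "extremal_poset (Restr r (Field r - {y})) = extremal_poset r"
proof -
  let ?A = "Field r - {y}"
  have F: "Field (Restr r ?A) = ?A" by (rule Field_Restr_Partial_order) (use assms in auto)
  have "minimal_points (Restr r ?A) ?A = minimal_points r ?A"
    "maximal_points (Restr r ?A) ?A = maximal_points r ?A"
    by (auto simp: minimal_points_def maximal_points_def)
  moreover have "minimal_points r ?A = minimal_points r (Field r)"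
    "maximal_points r ?A = maximal_points r (Field r)"
    using minimal_points_remove[OF assms(1-3)] maximal_points_remove[OF assms(1-3)] assms(4)
    by (simp_all add: extremal_points_def)
  moreover have "minimal_points r ?A \<subseteq> ?A" "maximal_points r ?A \<subseteq> ?A"
    by (auto simp: minimal_points_def maximal_points_def)
  ultimately have
    "minimal_points (Restr r ?A) ?A = minimal_points r (Field r)"
    "maximal_points (Restr r ?A) ?A = maximal_points r (Field r)"
    "minimal_points r (Field r) \<union> maximal_points r (Field r) \<subseteq> ?A"
    by simp_all
  then show ?thesis unfolding extremal_poset_def F by auto
qed

section \<open>Irreducible points outside E(P)\<close>

text \<open>Take \<open>y\<close> maximal among the non-extremal points above \<open>x\<close>. A
  point strictly above \<open>y\<close> is extremal but not minimal, hence a maximal point above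
  \<open>x\<close>, hence \<open>b\<close>. So \<open>b\<close> is the only point strictly above
  \<open>y\<close>.\<close>

lemma unique_maximal_above_irreducible:
  assumes "Partial_order r" "finite (Field r)"
    and x: "x \<in> Field r" "x \<notin> extremal_points r"
    and b: "\<And>c. c \<in> maximal_points r (Field r) \<Longrightarrow> (x, c) \<in> r \<Longrightarrow> c = b"
  shows "\<exists>y z. irreducible_via r y z \<and> y \<notin> extremal_points r"
proof -
  have po: "antisym r" "trans r" "(x, x) \<in> r"
    using assms(1) x(1) by (auto simp: partial_order_on_def preorder_on_def refl_on_def)
  let ?S = "{y \<in> Field r - extremal_points r. (x, y) \<in> r}"
  have "\<exists>m \<in> maximal_points r ?S. x = m \<or> (x, m) \<in> r"
    by (rule maximal_point_above) (use assms(2) po x in auto)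
  then obtain y where y: "y \<in> ?S" "\<And>z. z \<in> ?S \<Longrightarrow> (y, z) \<in> r \<Longrightarrow> z = y"
    unfolding maximal_points_def by blast
  have "z = b" if z: "z \<in> aboveS r y" for z
  proof -
    have yz: "(y, z) \<in> r" "z \<noteq> y" using z unfolding aboveS_def by auto
    then have zF: "z \<in> Field r" and xz: "(x, z) \<in> r"
      using y(1) po(2) by (auto simp: Field_def dest: transD)
    with y(2) yz have "z \<in> extremal_points r" by blast
    moreover have "z \<notin> minimal_points r (Field r)"
      using yz y(1) unfolding minimal_points_def by blast
    ultimately have "z \<in> maximal_points r (Field r)" unfolding extremal_points_def by blast
    with b xz show ?thesis by blast
  qed
  moreover have "aboveS r y \<noteq> {}"
    using y(1) unfolding extremal_points_def maximal_points_def aboveS_def by blast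
  ultimately have "aboveS r y = {b}" by blast
  then have "minimal_points r (aboveS r y) = {b}" by (auto simp: minimal_points_def)
  with y(1) show ?thesis unfolding irreducible_via_def by blast
qed

lemma extremal_points_converse: "extremal_points (r\<inverse>) = extremal_points r"
  by (auto simp: extremal_points_def minimal_points_converse)

lemma irreducible_via_converse: "irreducible_via (r\<inverse>) x z \<longleftrightarrow> irreducible_via r x z"
  by (auto simp: irreducible_via_def minimal_points_converse underS_def aboveS_def)

text \<open>Dual case: reversing the order swaps minimal and maximal points and keeps extremality
  and irreducibility.\<close>

lemma unique_minimal_below_irreducible:
  assumes "Partial_order r" "finite (Field r)"
    and "x \<in> Field r" "x \<notin> extremal_points r"
    and "\<And>c. c \<in> minimal_points r (Field r) \<Longrightarrow> (c, x) \<in> r \<Longrightarrow> c = b"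
  shows "\<exists>y z. irreducible_via r y z \<and> y \<notin> extremal_points r"
  using unique_maximal_above_irreducible[of "r\<inverse>" x b] assms
  by (simp add: extremal_points_converse irreducible_via_converse minimal_points_converse)

lemma non_extremal_irreducible:
  assumes "Partial_order r" "finite (Field r)"
    and x: "x \<in> Field r" "x \<notin> extremal_points r"
    and nc: "\<not> (\<exists>C. crown (extremal_poset r) C)"
  shows "\<exists>y z. irreducible_via r y z \<and> y \<notin> extremal_points r"
proof (rule ccontr)
  assume no: "\<not> ?thesis"
  \<comment> \<open>Without two distinct maximal points above \<open>x\<close>, some
    \<open>b\<close> would satisfy the uniqueness hypothesis.\<close>
  have "\<exists>b1 \<in> maximal_points r (Field r). \<exists>b2 \<in> maximal_points r (Field r).
      b1 \<noteq> b2 \<and> (x, b1) \<in> r \<and> (x, b2) \<in> r"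
    using unique_maximal_above_irreducible[OF assms(1-4)] no by metis
  then obtain b1 b2 where b: "b1 \<in> maximal_points r (Field r)" "b2 \<in> maximal_points r (Field r)"
    "b1 \<noteq> b2" "(x, b1) \<in> r" "(x, b2) \<in> r" by blast
  have "\<exists>a1 \<in> minimal_points r (Field r). \<exists>a2 \<in> minimal_points r (Field r).
      a1 \<noteq> a2 \<and> (a1, x) \<in> r \<and> (a2, x) \<in> r"
    using unique_minimal_below_irreducible[OF assms(1-4)] no by metis
  then obtain a1 a2 where a: "a1 \<in> minimal_points r (Field r)" "a2 \<in> minimal_points r (Field r)"
    "a1 \<noteq> a2" "(a1, x) \<in> r" "(a2, x) \<in> r" by blast
  have po: "antisym r" "trans r" using assms(1) by (auto simp: partial_order_on_def preorder_on_def)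
  let ?e = "extremal_poset r"
  have le: "(u, v) \<in> ?e" "u \<noteq> v" if uv: "u \<in> {a1, a2}" "v \<in> {b1, b2}" for u v
  proof -
    have "(u, x) \<in> r" "(x, v) \<in> r" using uv a b by blast+
    then have "(u, v) \<in> r" using po(2) by (blast dest: transD)
    with uv a b show "(u, v) \<in> ?e" unfolding extremal_poset_def by blast
    \<comment> \<open>The point \<open>x\<close> lies between \<open>u\<close> and \<open>v\<close>,
      so \<open>u = v\<close> would force \<open>u = x\<close>; but \<open>u\<close> is extremal and
      \<open>x\<close> is not.\<close>
    have "u \<noteq> x" using uv a x(2) unfolding extremal_points_def by blast
    then show "u \<noteq> v" using \<open>(u, x) \<in> r\<close> \<open>(x, v) \<in> r\<close> po(1) by (blast dest: antisymD)
  qed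
  have "\<exists>C. crown ?e C"
  \<comment> \<open>Through \<open>x\<close>, both minimal points lie below both maximal ones. Two
    neighbours for each of the four points suffice here, without a cyclic enumeration.\<close>
  proof (rule crown_if_two_neighbours[of "{a1, a2, b1, b2}"])
    show "{a1, a2, b1, b2} \<subseteq> Field ?e" using le(1) unfolding Field_def by blast
    fix u assume "u \<in> {a1, a2, b1, b2}"
    then consider "u \<in> {a1, a2}" | "u \<in> {b1, b2}" by blast
    then show "\<exists>y\<in>{a1, a2, b1, b2}. \<exists>z\<in>{a1, a2, b1, b2}.
        y \<noteq> z \<and> adjacent ?e u y \<and> adjacent ?e u z"
    proof cases
      case 1
      with le[of u b1] le[of u b2] have "adjacent ?e u b1" "adjacent ?e u b2"
        by (simp_all add: adjacent_def)
      with b(3) show ?thesis by blast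
    next
      case 2
      with le[of a1 u] le[of a2 u] have "adjacent ?e u a1" "adjacent ?e u a2"
        by (simp_all add: adjacent_def)
      with a(3) show ?thesis by blast
    qed
  qed simp_all
  with nc show False by blast
qed

section \<open>Choice of the point to remove and the induction\<close>

text \<open>No zigzag could leave a point without neighbours.\<close>

lemma connected_neighbour:
  assumes "connected_poset r" "card (Field r) > 1" "x \<in> Field r"
  shows "\<exists>y\<in>Field r. adjacent r x y"
proof (rule ccontr)
  assume no: "\<not> ?thesis"
  have "y = x" if "(x, y) \<in> (r \<union> r\<inverse>)\<^sup>*" for y
    using that
  proof induction
    case (step y z)
    then have "z \<in> Field r" by (auto simp: Field_def)
    with step no show ?case by (auto simp: adjacent_def)
  qed simp
  then have "Field r \<subseteq> {x}" using assms(1,3) unfolding connected_poset_def by blast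
  then have "card (Field r) \<le> card {x}" by (intro card_mono) auto
  with assms(2) show False by simp
qed

lemma single_neighbour_irreducible:
  assumes "x \<in> Field r" and z: "\<And>y. adjacent r x y \<longleftrightarrow> y = z"
  shows "irreducible_via r x z"
proof -
  have "(x, z) \<in> r \<or> (z, x) \<in> r" using z[of z] by (simp add: adjacent_def)
  then have "aboveS r x = {z} \<or> underS r x = {z}"
    using z unfolding adjacent_def aboveS_def underS_def by auto
  then have "minimal_points r (aboveS r x) = {z} \<or> maximal_points r (underS r x) = {z}"
    by (auto simp: minimal_points_def maximal_points_def)
  with assms(1) show ?thesis unfolding irreducible_via_def by blast
qed

text \<open>This is the induction step. Removing a non-extremal point leaves E(P) unchanged. If all
  points are extremal, E(P) is P itself, and a crown found after the removal would already be a
  crown of P.\<close>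

lemma irreducible_point_avoiding_crown:
  assumes "Partial_order r" "finite (Field r)" "connected_poset r" "card (Field r) > 1"
    and nc: "\<not> (\<exists>C. crown (extremal_poset r) C)"
  shows "\<exists>x z. irreducible_via r x z \<and>
    \<not> (\<exists>C. crown (extremal_poset (Restr r (Field r - {x}))) C)"
proof (cases "Field r \<subseteq> extremal_points r")
  case False
  then obtain x where "x \<in> Field r" "x \<notin> extremal_points r" by blast
  then obtain y z where y: "irreducible_via r y z" "y \<notin> extremal_points r"
    using non_extremal_irreducible assms(1,2) nc by metis
  then have "y \<in> Field r" unfolding irreducible_via_def by blast
  with y nc extremal_poset_remove[OF assms(1,2)] show ?thesis by metis
next
  case True
  then have E: "extremal_points r = Field r"
    by (auto simp: extremal_points_def minimal_points_def maximal_points_def)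
  have "extremal_poset r = r"
    using E unfolding extremal_poset_def extremal_points_def by (auto simp: Field_def)
  with nc have nc': "\<not> (\<exists>C. crown r C)" by simp
  have "Field r \<noteq> {}" using assms(4) by auto
  \<comment> \<open>Without crowns some point has at most one neighbour; connectedness then supplies
    exactly one.\<close>
  then obtain x where x: "x \<in> Field r"
    "\<And>y z. y \<in> Field r \<Longrightarrow> z \<in> Field r \<Longrightarrow> adjacent r x y \<Longrightarrow> adjacent r x z \<Longrightarrow> y = z"
    using crown_if_two_neighbours[OF assms(2) _ subset_refl] nc' by metis
  obtain z where z: "z \<in> Field r" "adjacent r x z"
    using connected_neighbour[OF assms(3,4) x(1)] by blast
  have "adjacent r x y \<longleftrightarrow> y = z" for y
    using x(2) z unfolding adjacent_def Field_def by blast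
  with x(1) have "irreducible_via r x z" by (rule single_neighbour_irreducible)
  moreover have "\<not> crown (extremal_poset (Restr r (Field r - {x}))) C" for C
    using nc' crown_Restr unfolding extremal_poset_def by blast
  ultimately show ?thesis by blast
qed

text \<open>Nonemptiness is the form of the size condition that the induction preserves, as the
  removal of points ends at a singleton.\<close>

lemma I_dismantlable_if_no_crown:
  assumes "Partial_order r" "finite (Field r)" "connected_poset r" "Field r \<noteq> {}"
    and "\<not> (\<exists>C. crown (extremal_poset r) C)"
  shows "\<exists>s. I_dismantlable r {(s, s)}"
  using assms
proof (induction "card (Field r)" arbitrary: r rule: less_induct)
  case less
  show ?case
  proof (cases "card (Field r) > 1")
    case True
    then obtain x z where x: "irreducible_via r x z"
      and nc: "\<not> (\<exists>C. crown (extremal_poset (Restr r (Field r - {x}))) C)"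
      using irreducible_point_avoiding_crown[OF less.prems(1-3) True less.prems(5)] by blast
    let ?r = "Restr r (Field r - {x})"
    have retr: "I_retraction r ?r (id(x := z))"
      using x unfolding I_retraction_def by fastforce
    have F: "Field ?r = Field r - {x}"
      using less.prems(1) by (rule Field_Restr_Partial_order) blast
    have xF: "x \<in> Field r" using x unfolding irreducible_via_def by blast
    have "card (Field r - {x}) = card (Field r) - 1" using xF by simp
    then have "card (Field ?r) < card (Field r)" "card (Field ?r) > 0"
      unfolding F using True by simp_all
    moreover from this have "Field ?r \<noteq> {}" unfolding card_gt_0_iff by blast
    moreover have "Partial_order ?r" using less.prems(1) by (rule Partial_order_Restr)
    moreover have "finite (Field ?r)" unfolding F using less.prems(2) by simp
    moreover have "connected_poset ?r"
      using connected_I_retraction less.prems(1-3) retr by blast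
    ultimately show ?thesis
      using less.hyps[of ?r] nc I_dismantlable_Cons[OF retr] by blast
  next
    case False
    with less.prems(2,4) have "card (Field r) = 1" by (simp add: card_gt_0_iff Suc_leI le_antisym)
    then obtain s where s: "Field r = {s}" by (rule card_1_singletonE)
    then have "r = {(s, s)}"
      using less.prems(1) by (auto simp: Field_def partial_order_on_def preorder_on_def refl_on_def)
    then have "I_dismantlable r {(s, s)}"
      \<comment> \<open>A singleton is reached with \<open>J = 0\<close>, that is, by no retraction
        at all.\<close>
      unfolding I_dismantlable_def by (intro exI[of _ 0] exI[of _ "\<lambda>_. r"]) simp
    then show ?thesis by blast
  qed
qed

theorem theorem6:
  fixes r :: "'a rel"
  assumes "Partial_order r"
    and "finite (Field r)"
    and "connected_poset r"
    and "card (Field r) > 1"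
    and "\<not> (\<exists>C. crown (extremal_poset r) C)"
  shows "\<exists>s. I_dismantlable r {(s, s)}"
  using assms by (intro I_dismantlable_if_no_crown) auto

end
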